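(* For every integer $n\geqslant 6$, the inversion mapping $f$ over $\mathbb{F}_{2^n}$ has second order differential uniformity $\delta^2(f)=8$.
   Context: Let $q=2^n$. The inversion mapping is the map $f:\mathbb{F}_q\to\mathbb{F}_q$ with $f(x)=x^{-1}$ for $x\neq 0$ and $f(0)=0$; it corresponds to the polynomial $f(x)=x^{q-2}$. For $\alpha,\alpha'\in\mathbb{F}_q$ put $D^2_{\alpha,\alpha'}f(x)=f(x)+f(x+\alpha)+f(x+\alpha')+f(x+\alpha+\alpha')$. The second order differential uniformity of $f$ over $\mathbb{F}_q$ is $$\delta^2(f)=\max_{\alpha,\alpha'\in\mathbb{F}_q^{\ast},\ \alpha\neq\alpha',\ \beta\in\mathbb{F}_q}\sharp\{x\in\mathbb{F}_q\mid D^2_{\alpha,\alpha'}f(x)=\beta\}.$$ *)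

theory Defs
  imports "HOL-Library.Cardinality" "HOL-Computational_Algebra.Primes"
begin

definition inversion_map :: "'a::field \<Rightarrow> 'a" where
  "inversion_map x = (if x = 0 then 0 else inverse x)"

(* The defining formula for characteristic 2, where no signs are needed. *)
definition second_derivative :: "('a::field \<Rightarrow> 'a) \<Rightarrow> 'a \<Rightarrow> 'a \<Rightarrow> 'a \<Rightarrow> 'a" where
  "second_derivative f \<alpha> \<alpha>' x = f x + f (x + \<alpha>) + f (x + \<alpha>') + f (x + \<alpha> + \<alpha>')"

(* The set under Max is always finite; it is empty, and the value unspecified,
   only when the field has fewer than two distinct nonzero elements. *)
definition second_order_differential_uniformity :: "('a::finite_field \<Rightarrow> 'a) \<Rightarrow> nat" where
  "second_order_differential_uniformity f =
     Max {card {x. second_derivative f \<alpha> \<alpha>' x = \<beta>} |\<alpha> \<alpha>' \<beta>.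
            \<alpha> \<noteq> 0 \<and> \<alpha>' \<noteq> 0 \<and> \<alpha> \<noteq> \<alpha>'}"

end

theory Submission
  imports Defs "HOL-Number_Theory.Residues" "HOL-Computational_Algebra.Polynomial"
begin

text \<open>
  Let \<open>V = {0, a, b, a + b}\<close>, \<open>c = a b (a + b)\<close> and \<open>P x = (\<Prod>v\<in>V. (x + v))\<close>, an additive map with
  kernel \<open>V\<close>. The second derivative of inversion is constant on \<open>V\<close> and equals \<open>c / P x\<close> off \<open>V\<close>, so a
  fibre consists of at most two cosets of \<open>V\<close>. Taking \<open>a = 1\<close>, there is a fibre with two cosets
  as soon as \<open>c = b\<^sup>2 + b\<close>, \<open>c = 1 + 1 / (z\<^sup>2 + z)\<close> and \<open>x\<^sup>2 + x = c z = z + 1 / (z + 1)\<close> are solvable with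
  \<open>z\<close> outside the field of four elements. In terms of the additive character
  \<open>\<chi> = (-1)\<^bsup>Tr\<^esup>\<close> this asks for \<open>\<chi> (1 + 1 / (z\<^sup>2 + z)) = \<chi> (z + 1 / (z + 1)) = 1\<close>.

  If \<open>n = 2 m\<close>, every such \<open>z\<close> in the subfield of order \<open>2\<^sup>m\<close> works, because \<open>\<chi>\<close> is trivial there. If \<open>n\<close> is odd,
  counting the solutions \<open>z\<close> with \<open>\<chi>\<close> leads to the Kloosterman sum \<open>K = (\<Sum>x\<noteq>0. \<chi> (x + 1 / x))\<close>, and
  there is none only if \<open>3 K = q + 1\<close>. This contradicts the bound of size \<open>K\<^sup>2 \<le> q + q\<^bsup>3/2\<^esup>\<close> (roughly) which
  Kloosterman's fourth moment argument gives, so that Weil's bound is not needed.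
\<close>

text \<open>In a finite field of characteristic 2 this is \<chi> = (-1)^Tr, by the additive form of
  Hilbert 90. Phrased through solvability, a value 1 directly supplies the root that the
  construction needs.\<close>

definition artin_schreier_char :: "'a::field \<Rightarrow> int" where
  "artin_schreier_char x = (if \<exists>y. y\<^sup>2 + y = x then 1 else -1)"

definition kloosterman_sum :: "'a::field \<Rightarrow> 'a \<Rightarrow> int" where
  "kloosterman_sum a b = (\<Sum>x\<in>-{0}. artin_schreier_char (a * x + b / x))"

definition pair_span :: "'a::field \<Rightarrow> 'a \<Rightarrow> 'a set" where
  "pair_span a b = {0, a, b, a + b}"

text \<open>In characteristic 2 this is the product of all \<open>x + v\<close> with \<open>v \<in> pair_span a b\<close>.\<close>

definition span_poly :: "'a::field \<Rightarrow> 'a \<Rightarrow> 'a \<Rightarrow> 'a" where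
  "span_poly a b x = (x\<^sup>2 + a * x)\<^sup>2 + b * (a + b) * (x\<^sup>2 + a * x)"

section \<open>The additive character and its orthogonality relations\<close>

lemma artin_schreier_char_cases: "artin_schreier_char x = 1 \<or> artin_schreier_char x = -1"
  by (simp add: artin_schreier_char_def)

lemma artin_schreier_char_eq_1_iff: "artin_schreier_char x = 1 \<longleftrightarrow> (\<exists>y. y\<^sup>2 + y = x)"
  by (simp add: artin_schreier_char_def)

lemma artin_schreier_char_0 [simp]: "artin_schreier_char 0 = 1"
  unfolding artin_schreier_char_eq_1_iff by (rule exI[of _ 0]) simp

context
  assumes two_eq_0: "(1 :: 'a::finite_field) + 1 = 0"
begin

lemma add_self [simp]: "(x :: 'a) + x = 0"
  using two_eq_0 by (metis distrib_left mult.right_neutral mult_zero_right)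

lemma numeral_2_eq_0 [simp]: "(2 :: 'a) = 0"
  using two_eq_0 by (simp only: one_add_one)

lemma add_self_left [simp]: "(x :: 'a) + (x + y) = y"
  by (simp flip: add.assoc)

lemma add_eq_0_iff_eq: "(x :: 'a) + y = 0 \<longleftrightarrow> x = y"
  by (metis add_self add_self_left add.right_neutral)

lemma square_add: "(x + y :: 'a)\<^sup>2 = x\<^sup>2 + y\<^sup>2"
  by (simp add: power2_sum)

lemma artin_schreier_eq_iff:
  fixes y z :: 'a
  shows "y\<^sup>2 + y = z\<^sup>2 + z \<longleftrightarrow> y = z \<or> y = z + 1"
proof
  assume "y\<^sup>2 + y = z\<^sup>2 + z"
  moreover have "(y + z) * (y + (z + 1)) = (y\<^sup>2 + y) + (z\<^sup>2 + z)"
    by (simp add: power2_eq_square algebra_simps)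
  ultimately have "(y + z) * (y + (z + 1)) = 0"
    by simp
  then show "y = z \<or> y = z + 1"
    by (simp add: add_eq_0_iff_eq)
next
  show "y = z \<or> y = z + 1 \<Longrightarrow> y\<^sup>2 + y = z\<^sup>2 + z"
    by (auto simp: square_add ac_simps)
qed

text \<open>The map z^2 + z is two-to-one onto its range, and 1 + \<chi> is 2 on that range and 0
  elsewhere.\<close>

lemma sum_artin_schreier:
  fixes g :: "'a \<Rightarrow> int"
  shows "(\<Sum>z\<in>UNIV. g (z\<^sup>2 + z)) = (\<Sum>t\<in>UNIV. (1 + artin_schreier_char t) * g t)"
proof -
  let ?p = "\<lambda>z :: 'a. z\<^sup>2 + z"
  have fib: "card {z. ?p z = ?p y} = 2" for y
  proof -
    have "{z. ?p z = ?p y} = {y, y + 1}"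
      by (auto simp: artin_schreier_eq_iff)
    then show ?thesis by simp
  qed
  have "(\<Sum>z\<in>UNIV. g (?p z)) = (\<Sum>t\<in>range ?p. \<Sum>z | z \<in> UNIV \<and> ?p z = t. g (?p z))"
    by (rule sum.image_gen) simp
  also have "\<dots> = (\<Sum>t\<in>range ?p. 2 * g t)"
    using fib by (intro sum.cong) auto
  also have "\<dots> = (\<Sum>t\<in>range ?p. (1 + artin_schreier_char t) * g t)"
    by (intro sum.cong) (auto simp: artin_schreier_char_def)
  also have "\<dots> = (\<Sum>t\<in>UNIV. (1 + artin_schreier_char t) * g t)"
    by (intro sum.mono_neutral_left) (auto simp: artin_schreier_char_def)
  finally show ?thesis .
qed

lemma sum_artin_schreier_char: "(\<Sum>x\<in>UNIV. artin_schreier_char (x :: 'a)) = 0"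
  using sum_artin_schreier[of "\<lambda>_. 1"] by (simp add: sum.distrib)

text \<open>The range of z^2 + z is an additive subgroup \<open>?H\<close> of index 2, and \<chi> is
  the sign that separates its two cosets.\<close>

lemma artin_schreier_char_add:
  fixes x y :: 'a
  shows "artin_schreier_char (x + y) = artin_schreier_char x * artin_schreier_char y"
proof -
  let ?H = "range (\<lambda>z :: 'a. z\<^sup>2 + z)"
  have chi: "artin_schreier_char z = (if z \<in> ?H then 1 else -1)" for z :: 'a
    by (auto simp: artin_schreier_char_def)
  have closed: "u + v \<in> ?H" if "u \<in> ?H" "v \<in> ?H" for u v
  proof -
    from that obtain s t where "u = s\<^sup>2 + s" "v = t\<^sup>2 + t" by auto
    then have "u + v = (s + t)\<^sup>2 + (s + t)"
      by (simp add: square_add algebra_simps)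
    then show ?thesis by blast
  qed
  have half: "2 * card ?H = CARD('a)"
  proof -
    have "int CARD('a) = (\<Sum>t\<in>UNIV. 1 + artin_schreier_char (t :: 'a))"
      using sum_artin_schreier[of "\<lambda>_. 1"] by simp
    also have "\<dots> = (\<Sum>t\<in>?H. 2)"
      by (intro sum.mono_neutral_cong_right) (auto simp: artin_schreier_char_def)
    finally show ?thesis by simp
  qed
  have index_2: "u + v \<in> ?H" if "u \<notin> ?H" "v \<notin> ?H" for u v
  proof -
    have "?H \<inter> (+) u ` ?H = {}"
    proof safe
      fix s t :: 'a assume "t\<^sup>2 + t = u + (s\<^sup>2 + s)"
      then have "u = (s\<^sup>2 + s) + (t\<^sup>2 + t)"
        by (simp add: ac_simps)
      then show "t\<^sup>2 + t \<in> {}" using that(1) closed by blast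
    qed
    then have "card (?H \<union> (+) u ` ?H) = CARD('a)"
      by (subst card_Un_disjoint) (simp_all add: card_image half[symmetric])
    then have "?H \<union> (+) u ` ?H = UNIV"
      by (intro card_subset_eq) auto
    with that(2) obtain h where "h \<in> ?H" "v = u + h" by blast
    then show ?thesis by simp
  qed
  have coset: "u + v \<notin> ?H" if "u \<in> ?H" "v \<notin> ?H" for u v
    using closed[of u "u + v"] that by auto
  show ?thesis
    using closed[of x y] index_2[of x y] coset[of x y] coset[of y x]
    unfolding chi by (simp add: add.commute[of y x])
qed

lemma artin_schreier_char_orthogonality:
  fixes s :: 'a
  shows "(\<Sum>a\<in>UNIV. artin_schreier_char (a * s)) = (if s = 0 then int CARD('a) else 0)"
proof (cases "s = 0")
  case False
  have "(\<Sum>a\<in>UNIV. artin_schreier_char (a * s)) = (\<Sum>x\<in>UNIV. artin_schreier_char (x :: 'a))"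
    by (rule sum.reindex_bij_witness[of _ "\<lambda>x. x / s" "\<lambda>a. a * s"]) (use False in auto)
  then show ?thesis using False sum_artin_schreier_char by simp
qed simp

text \<open>Expand the square into pairs (i, j). Averaging over a and b kills every pair except
  those on which g and h both agree; in characteristic 2 the difference g i - g j is g i + g
  j.\<close>

lemma artin_schreier_char_parseval:
  fixes g h :: "'i \<Rightarrow> 'a"
  assumes "finite I"
  shows "(\<Sum>a\<in>UNIV. \<Sum>b\<in>UNIV. (\<Sum>i\<in>I. artin_schreier_char (a * g i + b * h i))\<^sup>2)
    = (int CARD('a))\<^sup>2 * int (card {(i, j). i \<in> I \<and> j \<in> I \<and> g i = g j \<and> h i = h j})"
proof -
  let ?q = "int CARD('a)" and ?c = "artin_schreier_char :: 'a \<Rightarrow> int"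
  have "(\<Sum>i\<in>I. ?c (a * g i + b * h i))\<^sup>2
      = (\<Sum>(i, j)\<in>I \<times> I. ?c (a * (g i + g j)) * ?c (b * (h i + h j)))" for a b
    by (simp add: power2_eq_square sum_product sum.cartesian_product distrib_left
        artin_schreier_char_add ac_simps)
  then have "(\<Sum>a\<in>UNIV. \<Sum>b\<in>UNIV. (\<Sum>i\<in>I. ?c (a * g i + b * h i))\<^sup>2)
      = (\<Sum>a\<in>UNIV. \<Sum>b\<in>UNIV. \<Sum>(i, j)\<in>I \<times> I. ?c (a * (g i + g j)) * ?c (b * (h i + h j)))"
    by simp
  also have "\<dots> = (\<Sum>(i, j)\<in>I \<times> I. \<Sum>a\<in>UNIV. \<Sum>b\<in>UNIV. ?c (a * (g i + g j)) * ?c (b * (h i + h j)))"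
    by (simp add: case_prod_unfold sum.swap[of _ "I \<times> I"])
  also have "\<dots> = (\<Sum>(i, j)\<in>I \<times> I. (\<Sum>a\<in>UNIV. ?c (a * (g i + g j))) * (\<Sum>b\<in>UNIV. ?c (b * (h i + h j))))"
    by (simp add: sum_product)
  also have "\<dots> = (\<Sum>(i, j)\<in>I \<times> I. if g i = g j \<and> h i = h j then ?q\<^sup>2 else 0)"
    by (intro sum.cong) (auto simp: artin_schreier_char_orthogonality add_eq_0_iff_eq power2_eq_square)
  also have "\<dots> = (\<Sum>p\<in>{(i, j). i \<in> I \<and> j \<in> I \<and> g i = g j \<and> h i = h j}. ?q\<^sup>2)"
    by (rule sum.mono_neutral_cong_right) (use assms in \<open>auto split: if_splits\<close>)
  finally show ?thesis by simp
qed

subsection \<open>A Kloosterman sum\<close>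

lemma kloosterman_sum_inverse:
  fixes a :: 'a
  assumes "a \<noteq> 0"
  shows "kloosterman_sum a (1 / a) = kloosterman_sum 1 (1 :: 'a)"
  unfolding kloosterman_sum_def
  by (rule sum.reindex_bij_witness[of _ "\<lambda>y. y / a" "\<lambda>x. a * x"]) (use assms in auto)

text \<open>Dividing the sum x + y by the sum of inverses gives x y, so the unordered pair is
  determined. This needs x + y nonzero: all diagonal pairs share the values (0, 0).\<close>

lemma card_equal_sums_and_inverse_sums:
  fixes I :: "('a \<times> 'a) set"
  assumes I: "I = {(x, y). x \<noteq> 0 \<and> y \<noteq> 0 \<and> x \<noteq> y}"
  shows "card {(i, j). i \<in> I \<and> j \<in> I \<and> fst i + snd i = fst j + snd j
      \<and> 1 / fst i + 1 / snd i = 1 / fst j + 1 / snd j} \<le> 2 * card I" (is "card ?E \<le> _")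
proof -
  have "?E \<subseteq> (\<lambda>i. (i, i)) ` I \<union> (\<lambda>i. (i, prod.swap i)) ` I"
  proof safe
    fix x y u v :: 'a
    assume ij: "(x, y) \<in> I" "(u, v) \<in> I" "((x, y), (u, v)) \<notin> (\<lambda>i. (i, prod.swap i)) ` I"
      and s: "fst (x, y) + snd (x, y) = fst (u, v) + snd (u, v)"
      and t: "1 / fst (x, y) + 1 / snd (x, y) = 1 / fst (u, v) + 1 / snd (u, v)"
    have nz: "x \<noteq> 0" "y \<noteq> 0" "u \<noteq> 0" "v \<noteq> 0" "x + y \<noteq> 0"
      using ij(1,2) by (auto simp: I add_eq_0_iff_eq)
    have s: "x + y = u + v" using s by simp
    have "(x + y) / (x * y) = (u + v) / (u * v)"
      using t nz by (simp add: add_divide_distrib add.commute)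
    then have "x * y = u * v"
      using nz s by (simp add: divide_simps)
    moreover have "v = x + y + u" using s by (simp add: ac_simps)
    ultimately have "x * y + u * (x + y + u) = 0" by simp
    \<comment> \<open>Both pairs are the roots of one quadratic, so u is x or y.\<close>
    then have "(u + x) * (u + y) = 0" by (simp add: algebra_simps)
    then have "u = x \<and> v = y \<or> u = y \<and> v = x"
      using s by (auto simp: add_eq_0_iff_eq add.commute)
    with ij show "((x, y), (u, v)) \<in> (\<lambda>i. (i, i)) ` I" by auto
  qed
  then have "card ?E \<le> card ((\<lambda>i. (i, i)) ` I \<union> (\<lambda>i. (i, prod.swap i)) ` I)"
    by (intro card_mono) auto
  also have "\<dots> \<le> card I + card I"
    by (rule order_trans[OF card_Un_le]) (intro add_mono card_image_le, auto)
  finally show ?thesis by simp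
qed

text \<open>
  Removing the diagonal \<open>x = y\<close> from \<open>K\<^sup>2 = (\<Sum>x y. \<dots>)\<close> before taking the second moment is what makes
  the bound strong enough for \<open>q = 128\<close>; the plain fourth moment is not.
\<close>

lemma kloosterman_sum_moment_bound:
  fixes q :: int
  defines "q \<equiv> int CARD('a)"
  assumes "q \<ge> 4"
  shows "((kloosterman_sum 1 (1::'a))\<^sup>2 - (q - 1))\<^sup>2 \<le> 2 * q\<^sup>2 * (q - 2) - (q - 1) * (q - 2)\<^sup>2"
proof -
  let ?c = "artin_schreier_char :: 'a \<Rightarrow> int" and ?K = "kloosterman_sum 1 (1 :: 'a)"
  define U :: "'a set" where "U = -{0}"
  define I :: "('a \<times> 'a) set" where "I = {(x, y). x \<noteq> 0 \<and> y \<noteq> 0 \<and> x \<noteq> y}"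
  define L :: "'a \<Rightarrow> 'a \<Rightarrow> int" where
    "L a b = (\<Sum>i\<in>I. ?c (a * (fst i + snd i) + b * (1 / fst i + 1 / snd i)))" for a b
  have cardU: "int (card U) = q - 1"
    unfolding U_def q_def by (simp add: card_Diff_subset Compl_eq_Diff_UNIV of_nat_diff)
  have UU: "U \<times> U = I \<union> (\<lambda>x. (x, x)) ` U" "I \<inter> (\<lambda>x. (x, x)) ` U = {}"
    by (auto simp: U_def I_def)
  have L: "L a b = (kloosterman_sum a b)\<^sup>2 - (q - 1)" for a b
  proof -
    let ?f = "\<lambda>i. ?c (a * (fst i + snd i) + b * (1 / fst i + 1 / snd i))"
    have "(kloosterman_sum a b)\<^sup>2 = (\<Sum>i\<in>U \<times> U. ?f i)"
      by (simp add: kloosterman_sum_def U_def[symmetric] power2_eq_square sum_product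
          sum.cartesian_product case_prod_unfold distrib_left flip: artin_schreier_char_add)
        (simp add: ac_simps)
    also have "\<dots> = L a b + (\<Sum>i\<in>(\<lambda>x. (x, x)) ` U. ?f i)"
      unfolding UU(1) L_def by (rule sum.union_disjoint) (use UU(2) in auto)
    also have "(\<Sum>i\<in>(\<lambda>x. (x, x)) ` U. ?f i) = q - 1"
      by (subst sum.reindex) (simp_all add: inj_on_def cardU)
    finally show ?thesis by simp
  qed
  have "int (card I) = (q - 1)\<^sup>2 - (q - 1)"
    using L[of 0 0] by (simp add: L_def kloosterman_sum_def cardU flip: U_def)
  then have cardI: "int (card I) = (q - 1) * (q - 2)"
    by (simp add: power2_eq_square algebra_simps)
  \<comment> \<open>Only (0, 0) and the q - 1 points of the hyperbola a b = 1 are kept from the full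
    second moment; on the hyperbola every Kloosterman sum equals \<open>?K\<close>.\<close>
  have "(q - 1)\<^sup>2 * (q - 2)\<^sup>2 + (q - 1) * (?K\<^sup>2 - (q - 1))\<^sup>2
      = (L 0 0)\<^sup>2 + (\<Sum>a\<in>U. (L a (1 / a))\<^sup>2)"
  proof -
    have "(\<Sum>a\<in>U. (L a (1 / a))\<^sup>2) = (\<Sum>a\<in>U. (?K\<^sup>2 - (q - 1))\<^sup>2)"
      by (intro sum.cong refl) (simp add: L kloosterman_sum_inverse U_def)
    moreover have "L 0 0 = (q - 1) * (q - 2)"
      unfolding cardI[symmetric] by (simp add: L_def)
    ultimately show ?thesis
      by (simp add: cardU power_mult_distrib)
  qed
  also have "\<dots> = (\<Sum>(a, b)\<in>insert (0, 0) ((\<lambda>a. (a, 1 / a)) ` U). (L a b)\<^sup>2)"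
    by (subst sum.insert) (auto simp: sum.reindex inj_on_def U_def)
  also have "\<dots> \<le> (\<Sum>(a, b)\<in>UNIV. (L a b)\<^sup>2)"
    by (rule sum_mono2) auto
  also have "\<dots> = (\<Sum>a\<in>UNIV. \<Sum>b\<in>UNIV. (L a b)\<^sup>2)"
    by (simp add: sum.cartesian_product)
  also have "\<dots> \<le> q\<^sup>2 * (2 * int (card I))"
    unfolding L_def
    by (subst artin_schreier_char_parseval)
      (use card_equal_sums_and_inverse_sums[OF I_def] in \<open>auto simp: q_def\<close>)
  finally have "(q - 1) * (?K\<^sup>2 - (q - 1))\<^sup>2
      \<le> (q - 1) * (2 * q\<^sup>2 * (q - 2) - (q - 1) * (q - 2)\<^sup>2)"
    unfolding cardI by (simp add: power2_eq_square algebra_simps)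
  then show ?thesis using assms(2) by simp
qed

text \<open>Expand the product of the two factors 1 + \<chi>. As \<chi>(1) = -1, each of the three
  character sums over z outside {0, 1} equals 1 - K, so without a solution q - 2 + 3 (1 - K) =
  0.\<close>

lemma exists_artin_schreier_char_pair_odd:
  assumes "CARD('a) \<ge> 128" and chi_1: "artin_schreier_char (1 :: 'a) = -1"
  shows "\<exists>z::'a. z \<noteq> 0 \<and> z \<noteq> 1 \<and> artin_schreier_char (1 + 1 / (z\<^sup>2 + z)) = 1
      \<and> artin_schreier_char (z + 1 / (z + 1)) = 1"
proof (rule ccontr)
  assume none: "\<not> ?thesis"
  let ?c = "artin_schreier_char :: 'a \<Rightarrow> int"
  define q where "q = int CARD('a)"
  define K where "K = kloosterman_sum 1 (1 :: 'a)"
  define S :: "'a set" where "S = -{0, 1}"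
  have q: "q \<ge> 128" using assms(1) by (simp add: q_def)
  have S: "z \<noteq> 0" "z + 1 \<noteq> 0" if "z \<in> S" for z
    using that by (auto simp: S_def add_eq_0_iff_eq)
  have cardS: "int (card S) = q - 2"
    unfolding S_def q_def using assms(1)
    by (simp add: card_Diff_subset Compl_eq_Diff_UNIV of_nat_diff)
  have sum_S: "(\<Sum>z\<in>S. ?c (z + 1 / z)) = K - 1"
  proof -
    have "-{0} = insert 1 S" "1 \<notin> S" by (auto simp: S_def)
    then show ?thesis by (simp add: K_def kloosterman_sum_def)
  qed
  have translate: "(\<Sum>z\<in>S. ?c ((z + 1 / z) + 1)) = 1 - K"
    by (simp add: artin_schreier_char_add[of _ 1] chi_1 sum_negf sum_S)
  have shift: "(\<Sum>z\<in>S. ?c (z + 1 / (z + 1))) = 1 - K"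
  proof -
    have "(\<Sum>z\<in>S. ?c (z + 1 / (z + 1))) = (\<Sum>z\<in>S. ?c ((z + 1 / z) + 1))"
      by (rule sum.reindex_bij_witness[of _ "\<lambda>z. z + 1" "\<lambda>z. z + 1"])
        (auto simp: S_def add_eq_0_iff_eq ac_simps)
    with translate show ?thesis by simp
  qed
  have double: "(\<Sum>z\<in>S. ?c (1 / (z\<^sup>2 + z))) = K - 1"
  proof -
    \<comment> \<open>The value 0 at t = 0 discards z = 0 and z = 1; the convention 1 / 0 = 0 would
      make them count 1 each.\<close>
    let ?g = "\<lambda>t :: 'a. if t = 0 then 0 else ?c (1 / t)"
    have "(\<Sum>z\<in>S. ?c (1 / (z\<^sup>2 + z))) = (\<Sum>z\<in>UNIV. ?g (z\<^sup>2 + z))"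
    proof (rule sum.mono_neutral_cong_left)
      show "\<forall>z\<in>UNIV - S. ?g (z\<^sup>2 + z) = 0" by (auto simp: S_def)
      fix z assume z: "z \<in> S"
      have "z\<^sup>2 + z = z * (z + 1)" by (simp add: power2_eq_square algebra_simps)
      then show "?c (1 / (z\<^sup>2 + z)) = ?g (z\<^sup>2 + z)" using S[OF z] by simp
    qed auto
    also have "\<dots> = (\<Sum>t\<in>UNIV. (1 + ?c t) * ?g t)"
      by (rule sum_artin_schreier)
    also have "\<dots> = (\<Sum>t\<in>-{0}. ?c (1 / t) + ?c (t + 1 / t))"
      by (rule sum.mono_neutral_cong_right) (auto simp: artin_schreier_char_add algebra_simps)
    also have "\<dots> = (\<Sum>t\<in>-{0}. ?c (1 / t)) + K"
      by (simp add: sum.distrib K_def kloosterman_sum_def)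
    also have "(\<Sum>t\<in>-{0}. ?c (1 / t)) = (\<Sum>t\<in>-{0}. ?c t)"
      by (rule sum.reindex_bij_witness[of _ "\<lambda>t. 1 / t" "\<lambda>t. 1 / t"]) auto
    also have "\<dots> = -1"
      using sum_artin_schreier_char sum.remove[of UNIV "0 :: 'a" ?c]
      by (simp add: Compl_eq_Diff_UNIV)
    finally show ?thesis by simp
  qed
  have double_translate: "(\<Sum>z\<in>S. ?c (1 + 1 / (z\<^sup>2 + z))) = 1 - K"
    by (simp add: artin_schreier_char_add[of 1] chi_1 sum_negf double)
  \<comment> \<open>By partial fractions 1 / (z^2 + z) = 1 / z + 1 / (z + 1), so the term 1 / (z +
    1) cancels and a translated Kloosterman argument remains.\<close>
  have arg: "(1 + 1 / (z\<^sup>2 + z)) + (z + 1 / (z + 1)) = (z + 1 / z) + 1" if "z \<in> S" for z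
  proof -
    have "1 / z + 1 / (z + 1) = ((z + 1) + z) / (z * (z + 1))"
      using add_frac_eq[OF S[OF that], of 1 1] by simp
    also have "\<dots> = 1 / (z\<^sup>2 + z)"
      by (simp add: power2_eq_square algebra_simps)
    finally have "1 / (z\<^sup>2 + z) = 1 / z + 1 / (z + 1)" by simp
    then show ?thesis by (simp add: ac_simps)
  qed
  have "0 = (\<Sum>z\<in>S. (1 + ?c (1 + 1 / (z\<^sup>2 + z))) * (1 + ?c (z + 1 / (z + 1))))"
  proof (rule sum.neutral[symmetric], rule ballI)
    fix z assume "z \<in> S"
    with none have "?c (1 + 1 / (z\<^sup>2 + z)) = -1 \<or> ?c (z + 1 / (z + 1)) = -1"
      using artin_schreier_char_cases by (fastforce simp: S_def)
    then show "(1 + ?c (1 + 1 / (z\<^sup>2 + z))) * (1 + ?c (z + 1 / (z + 1))) = 0"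
      by auto
  qed
  also have "\<dots> = (\<Sum>z\<in>S. 1 + ?c (1 + 1 / (z\<^sup>2 + z)) + ?c (z + 1 / (z + 1))
      + ?c ((z + 1 / z) + 1))"
  proof (rule sum.cong[OF refl])
    fix z assume "z \<in> S"
    then show "(1 + ?c (1 + 1 / (z\<^sup>2 + z))) * (1 + ?c (z + 1 / (z + 1)))
        = 1 + ?c (1 + 1 / (z\<^sup>2 + z)) + ?c (z + 1 / (z + 1)) + ?c ((z + 1 / z) + 1)"
      unfolding arg[OF \<open>z \<in> S\<close>, symmetric] artin_schreier_char_add[of "1 + 1 / (z\<^sup>2 + z)"]
      by (simp add: algebra_simps)
  qed
  also have "\<dots> = (q - 2) - (K - 1) + (1 - K) - (K - 1)"
    by (simp add: sum.distrib translate shift double_translate cardS)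
  finally have K: "3 * K = q + 1" by simp
  have bound: "(K\<^sup>2 - (q - 1))\<^sup>2 \<le> 2 * q\<^sup>2 * (q - 2) - (q - 1) * (q - 2)\<^sup>2"
    unfolding K_def q_def by (rule kloosterman_sum_moment_bound) (use assms(1) in simp)
  \<comment> \<open>\<open>q \<ge> 128\<close> and \<open>3 * K = q + 1\<close> give \<open>K \<ge> 43\<close>; in terms of \<open>k\<close> all coefficients are positive.\<close>
  define k where "k = K - 43"
  have k: "k \<ge> 0" "K = k + 43" "q = 3 * k + 128"
    using K q by (auto simp: k_def)
  have "(K\<^sup>2 - (q - 1))\<^sup>2 - (2 * q\<^sup>2 * (q - 2) - (q - 1) * (q - 2)\<^sup>2)
      = k ^ 4 + 139 * k ^ 3 + 6868 * k\<^sup>2 + 137652 * k + 852768"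
    unfolding k(2,3) by (simp add: power2_eq_square power3_eq_cube power4_eq_xxxx algebra_simps)
  also have "\<dots> > 0"
    using k(1) by (intro add_nonneg_pos) auto
  finally show False using bound by simp
qed

subsection \<open>Existence of the parameter\<close>

lemma add_power_two_power: "(x + y :: 'a) ^ 2 ^ k = x ^ 2 ^ k + y ^ 2 ^ k"
  by (induction k) (simp_all add: power_mult square_add power2_eq_square[symmetric] mult.commute[of 2])

text \<open>A root of y^2 + y = 1 lies in the field of four elements, so squaring twice fixes it.
  For odd n, y^q = y then becomes y^2 = y.\<close>

lemma artin_schreier_char_1_odd:
  assumes "CARD('a) = 2 ^ n" "odd n"
  shows "artin_schreier_char (1 :: 'a) = -1"
proof -
  have "y\<^sup>2 + y \<noteq> 1" for y :: 'a
  proof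
    assume y: "y\<^sup>2 + y = 1"
    then have sq: "y\<^sup>2 = y + 1"
      by (metis add_self_left add.commute)
    have "y ^ 2 ^ (2 * m) = y" for m
    proof (induction m)
      case (Suc m)
      have "y ^ 2 ^ (2 * Suc m) = ((y ^ 2 ^ (2 * m))\<^sup>2)\<^sup>2"
        by (simp flip: power_mult)
      also have "\<dots> = y"
        by (simp only: Suc sq square_add) (simp add: add.assoc)
      finally show ?case .
    qed simp
    moreover obtain m where "n = Suc (2 * m)"
      using assms(2) by (auto elim: oddE)
    ultimately have "y ^ CARD('a) = y\<^sup>2"
      by (simp add: assms(1) mult.commute[of 2] power_mult)
    then have "y\<^sup>2 = y"
      by (simp add: finite_field_power_card_eq_same)
    with y show False by simp
  qed
  then show ?thesis by (simp add: artin_schreier_char_def)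
qed

text \<open>The relative trace w^Q + w lies in the subfield of order Q. As a polynomial in w, z^4 +
  z has degree 4 Q < Q^2, so it is nonzero for some w.\<close>

lemma exists_proper_subfield_trace:
  assumes "CARD('a) = Q\<^sup>2" and Q: "Q = 2 ^ m" "m \<ge> 3"
  obtains w z :: 'a where "z = w ^ Q + w" "z ^ Q = z" "z ^ 4 \<noteq> z"
proof -
  have Q8: "Q \<ge> 8"
    using power_increasing[OF Q(2), of "2 :: nat"] by (simp add: Q(1))
  define p :: "'a poly" where "p = monom 1 (4 * Q) + (monom 1 Q + monom 1 4 + monom 1 1)"
  have deg: "degree p = 4 * Q"
    unfolding p_def using Q8
    by (subst degree_add_eq_left)
      (auto simp: degree_monom_eq intro!: le_less_trans[OF degree_add_le] degree_add_less)
  then have "p \<noteq> 0" using Q8 by auto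
  then have "card {w. poly p w = 0} \<le> 4 * Q"
    using card_poly_roots_bound deg by metis
  also have "\<dots> < CARD('a)"
    using Q8 by (simp add: assms(1) power2_eq_square)
  finally have "{w. poly p w = 0} \<noteq> UNIV" by auto
  then obtain w where w: "poly p w \<noteq> 0" by blast
  define z where "z = w ^ Q + w"
  have "(w ^ Q) ^ Q = w"
    using finite_field_power_card_eq_same[of w]
    by (simp add: assms(1) power2_eq_square power_mult)
  then have "z ^ Q = z"
    unfolding z_def Q(1) by (simp add: add_power_two_power add.commute)
  moreover have "z ^ 4 \<noteq> z"
  proof
    assume "z ^ 4 = z"
    moreover have "z ^ 4 = w ^ (4 * Q) + w ^ 4"
      using add_power_two_power[of "w ^ Q" w 2]
      by (simp add: z_def mult.commute[of 4] power_mult)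
    ultimately have "w ^ (4 * Q) + w ^ 4 + (w ^ Q + w) = 0"
      by (simp add: z_def)
    with w show False
      by (simp add: p_def poly_monom ac_simps)
  qed
  ultimately show ?thesis using that z_def by blast
qed

text \<open>The sum telescopes: \<open>w ^ 2 ^ m + w\<close> is \<open>y\<^sup>2 + y\<close> with \<open>y = (\<Sum>i<m. w ^ 2 ^ i)\<close>.\<close>

lemma artin_schreier_char_relative_trace:
  fixes w :: 'a
  shows "artin_schreier_char (w ^ 2 ^ m + w) = 1"
proof (induction m)
  case (Suc m)
  let ?u = "w ^ 2 ^ m"
  have "w ^ 2 ^ Suc m = ?u\<^sup>2"
    by (simp add: mult.commute[of 2] power_mult)
  then have "w ^ 2 ^ Suc m + w = (?u\<^sup>2 + ?u) + (?u + w)"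
    by (simp add: add.assoc)
  then show ?case
    using Suc artin_schreier_char_add artin_schreier_char_eq_1_iff by (metis mult_1)
qed simp

lemma exists_artin_schreier_char_pair:
  assumes card: "CARD('a) = 2 ^ n" and n: "n \<ge> 6"
  shows "\<exists>z::'a. z ^ 4 \<noteq> z \<and> artin_schreier_char (1 + 1 / (z\<^sup>2 + z)) = 1
      \<and> artin_schreier_char (z + 1 / (z + 1)) = 1"
proof (cases "even n")
  case True
  then obtain m where m: "n = 2 * m" by blast
  define Q where "Q = (2 :: nat) ^ m"
  have "CARD('a) = Q\<^sup>2" by (simp add: card m Q_def mult.commute flip: power_mult)
  moreover have "m \<ge> 3" using n m by simp
  ultimately obtain w z :: 'a where z: "z = w ^ Q + w" "z ^ Q = z" "z ^ 4 \<noteq> z"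
    using exists_proper_subfield_trace Q_def by metis
  have nz: "z \<noteq> 0" using z(3) by auto
  \<comment> \<open>The trace is linear over the subfield: scaling w by u / z turns its trace z into
    u, so all of the subfield consists of traces.\<close>
  have sub: "artin_schreier_char u = 1" if "u ^ Q = u" for u :: 'a
  proof -
    have "u = (w * u / z) ^ Q + w * u / z"
    proof -
      have "(w * u / z) ^ Q + w * u / z = (w ^ Q + w) * u / z"
        by (simp add: power_mult_distrib power_divide z(2) that add_divide_distrib distrib_right)
      then show ?thesis using nz z(1) by simp
    qed
    then show ?thesis
      using artin_schreier_char_relative_trace unfolding Q_def by metis
  qed
  have add: "(u + v) ^ Q = u ^ Q + v ^ Q" for u v :: 'a
    unfolding Q_def by (rule add_power_two_power)
  have "(z\<^sup>2) ^ Q = z\<^sup>2"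
    by (metis z(2) power_mult mult.commute)
  then have "(1 + 1 / (z\<^sup>2 + z)) ^ Q = 1 + 1 / (z\<^sup>2 + z)" "(z + 1 / (z + 1)) ^ Q = z + 1 / (z + 1)"
    by (simp_all add: add power_divide z(2))
  with sub z(3) show ?thesis by blast
next
  case False
  then have chi_1: "artin_schreier_char (1 :: 'a) = -1"
    using artin_schreier_char_1_odd card by blast
  from False n have "n \<ge> 7" by (cases "n = 6") auto
  then have "CARD('a) \<ge> 128"
    using power_increasing[of 7 n "2 :: nat"] by (simp add: card)
  then obtain z :: 'a where z: "z \<noteq> 0" "z \<noteq> 1"
    "artin_schreier_char (1 + 1 / (z\<^sup>2 + z)) = 1" "artin_schreier_char (z + 1 / (z + 1)) = 1"
    using exists_artin_schreier_char_pair_odd chi_1 by blast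
  have "z ^ 4 \<noteq> z"
  proof
    assume "z ^ 4 = z"
    \<comment> \<open>Thus z^4 = z forces z^2 + z to be 0 or 1; the first gives z = 0 or z = 1, the
      second contradicts \<chi>(1) = -1.\<close>
    moreover have "(z\<^sup>2 + z)\<^sup>2 + (z\<^sup>2 + z) = z ^ 4 + z"
      by (simp add: square_add ac_simps flip: power_mult)
    ultimately have "(z\<^sup>2 + z)\<^sup>2 + (z\<^sup>2 + z) = 0\<^sup>2 + 0" by simp
    then have "z\<^sup>2 + z = 0 \<or> z\<^sup>2 + z = 1"
      unfolding artin_schreier_eq_iff by simp
    moreover have "z\<^sup>2 + z \<noteq> 1"
      using chi_1 artin_schreier_char_eq_1_iff[of "1 :: 'a"] by auto
    moreover have "z\<^sup>2 + z \<noteq> 0\<^sup>2 + 0"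
      unfolding artin_schreier_eq_iff using z by simp
    ultimately show False by simp
  qed
  with z show ?thesis by blast
qed

subsection \<open>Second derivatives of inversion\<close>

lemma pair_span_add: "u \<in> pair_span a b \<Longrightarrow> v \<in> pair_span a b \<Longrightarrow> u + v \<in> pair_span a (b :: 'a)"
  by (auto simp: pair_span_def ac_simps)

lemma card_pair_span:
  "a \<noteq> 0 \<Longrightarrow> b \<noteq> 0 \<Longrightarrow> a \<noteq> b \<Longrightarrow> card (pair_span a (b :: 'a)) = 4"
  by (simp add: pair_span_def add_eq_0_iff_eq eq_commute[of _ "_ + _"])

text \<open>Translation by an element of the span only permutes the four arguments of f.\<close>

lemma second_derivative_add_pair_span:
  fixes a b v x :: 'a
  assumes "v \<in> pair_span a b"
  shows "second_derivative f a b (x + v) = second_derivative f a b x"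
  using assms by (auto simp: pair_span_def second_derivative_def ac_simps)

lemma span_poly_add: "span_poly a b (x + y :: 'a) = span_poly a b x + span_poly a b y"
proof -
  have "(x + y)\<^sup>2 + a * (x + y) = (x\<^sup>2 + a * x) + (y\<^sup>2 + a * y)"
    by (simp add: square_add algebra_simps)
  then show ?thesis
    unfolding span_poly_def by (simp only: square_add distrib_left ac_simps)
qed

lemma span_poly_factor: "span_poly a b (x :: 'a) = x * (x + a) * ((x + b) * (x + (a + b)))"
proof -
  have "x\<^sup>2 + a * x = x * (x + a)"
    by (simp add: power2_eq_square algebra_simps)
  moreover have "(x + b) * (x + (a + b)) = x * (x + a) + b * (a + b)"
    by (simp add: algebra_simps)
  ultimately show ?thesis
    unfolding span_poly_def by (simp add: power2_eq_square algebra_simps)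
qed

lemma span_poly_eq_0_iff: "span_poly a b (x :: 'a) = 0 \<longleftrightarrow> x \<in> pair_span a b"
  by (auto simp: span_poly_factor pair_span_def add_eq_0_iff_eq)

lemma second_derivative_inversion_map:
  fixes a b x :: 'a
  assumes "x \<notin> pair_span a b"
  shows "second_derivative inversion_map a b x = a * b * (a + b) / span_poly a b x"
proof -
  have nz: "x \<noteq> 0" "x + a \<noteq> 0" "x + b \<noteq> 0" "x + (a + b) \<noteq> 0"
    using assms by (auto simp: pair_span_def add_eq_0_iff_eq)
  have inv_add: "inverse u + inverse v = (u + v) / (u * v)" if "u \<noteq> 0" "v \<noteq> 0" for u v :: 'a
    using that by (simp add: divide_simps add.commute)
  have "second_derivative inversion_map a b x
      = (inverse x + inverse (x + a)) + (inverse (x + b) + inverse (x + (a + b)))"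
    by (simp add: second_derivative_def inversion_map_def add.assoc)
  also have "\<dots> = a / (x * (x + a)) + a / ((x + b) * (x + (a + b)))"
    using nz by (simp add: inv_add ac_simps)
  also have "\<dots> = a * (inverse (x * (x + a)) + inverse ((x + b) * (x + (a + b))))"
    by (simp add: divide_inverse distrib_left)
  also have "\<dots> = a * (x * (x + a) + (x + b) * (x + (a + b))) / span_poly a b x"
    using nz by (subst inv_add) (simp_all add: span_poly_factor)
  also have "x * (x + a) + (x + b) * (x + (a + b)) = b * (a + b)"
    by (simp add: algebra_simps)
  finally show ?thesis by (simp add: mult.assoc)
qed

text \<open>The span itself contributes at most 4 points. Off it, equal derivatives mean equal
  values of the additive \<open>span_poly a b\<close>, hence at most one coset of its
  kernel.\<close>

lemma card_second_derivative_inversion_map_le: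
  fixes a b :: 'a
  assumes "a \<noteq> 0" "b \<noteq> 0" "a \<noteq> b"
  shows "card {x. second_derivative inversion_map a b x = \<beta>} \<le> 8"
proof -
  let ?V = "pair_span a b" and ?D = "second_derivative inversion_map a b"
  let ?B = "{x. x \<notin> ?V \<and> ?D x = \<beta>}"
  have "a * b * (a + b) \<noteq> 0"
    using assms by (simp add: add_eq_0_iff_eq)
  have "card ?B \<le> 4"
  proof (cases "?B = {}")
    case False
    then obtain y where y: "y \<notin> ?V" "?D y = \<beta>" by blast
    have "?B \<subseteq> (+) y ` ?V"
    proof safe
      fix x assume x: "x \<notin> ?V" "\<beta> = ?D x"
      have "span_poly a b x = span_poly a b y"
        using x y second_derivative_inversion_map[OF x(1)] second_derivative_inversion_map[OF y(1)]
          \<open>a * b * (a + b) \<noteq> 0\<close> span_poly_eq_0_iff[of a b] by (simp add: divide_simps)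
      then have "y + x \<in> ?V"
        by (simp add: span_poly_add flip: span_poly_eq_0_iff)
      then have "y + (y + x) \<in> (+) y ` ?V" by blast
      then show "x \<in> (+) y ` ?V" by simp
    qed
    then have "card ?B \<le> card ((+) y ` ?V)"
      by (intro card_mono) simp_all
    then show ?thesis
      using assms by (simp add: card_image card_pair_span)
  qed (simp only: card.empty)
  moreover have "card {x. ?D x = \<beta>} \<le> card (?V \<union> ?B)"
    by (rule card_mono) auto
  ultimately show ?thesis
    using card_Un_le[of ?V ?B] assms by (simp add: card_pair_span)
qed

text \<open>The character conditions supply b and x; \<beta> is the derivative at 0, attained on
  both \<open>?V\<close> and the coset x + \<open>?V\<close>.\<close>

lemma exists_card_second_derivative_inversion_map:
  fixes z :: 'a
  assumes z: "z ^ 4 \<noteq> z"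
    and "artin_schreier_char (1 + 1 / (z\<^sup>2 + z)) = 1"
    and "artin_schreier_char (z + 1 / (z + 1)) = 1"
  shows "\<exists>b \<beta> :: 'a. b \<noteq> 0 \<and> b \<noteq> 1 \<and> card {x. second_derivative inversion_map 1 b x = \<beta>} \<ge> 8"
proof -
  obtain b x where b: "b\<^sup>2 + b = 1 + 1 / (z\<^sup>2 + z)" and x: "x\<^sup>2 + x = z + 1 / (z + 1)"
    using assms(2,3) unfolding artin_schreier_char_eq_1_iff by blast
  define t c where "t = z\<^sup>2 + z" and "c = b\<^sup>2 + b"
  let ?V = "pair_span 1 b" and ?D = "second_derivative inversion_map 1 b"
  have "t\<^sup>2 + t = z ^ 4 + z"
    by (simp add: t_def square_add ac_simps flip: power_mult)
  with z have t: "t \<noteq> 0" "t \<noteq> 1"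
    by (auto simp: add_eq_0_iff_eq)
  have factor: "t = z * (z + 1)" "c = b * (1 + b)"
    by (simp_all add: t_def c_def power2_eq_square algebra_simps)
  have c: "c = 1 + 1 / t" "1 + c = 1 / t"
    using b by (simp_all add: t_def c_def)
  then have "c \<noteq> 0"
    using t by (auto simp: add_eq_0_iff_eq)
  then have b01: "b \<noteq> 0" "b \<noteq> 1"
    by (auto simp: factor(2))
  have D0: "?D 0 = (1 + c) / c"
  proof -
    have "?D 0 = 1 + (1 / b + 1 / (1 + b))"
      by (simp add: second_derivative_def inversion_map_def inverse_eq_divide add.assoc)
    also have "1 / b + 1 / (1 + b) = 1 / c"
      using \<open>c \<noteq> 0\<close> by (subst add_frac_eq) (auto simp: factor(2) ac_simps)
    finally show ?thesis
      using \<open>c \<noteq> 0\<close> by (simp add: add_divide_distrib add.commute)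
  qed
  have "x\<^sup>2 + x = c * z"
    using t(1) unfolding x c(1) by (simp add: factor(1) distrib_right)
  \<comment> \<open>With x^2 + x = c z the polynomial becomes c^2 (z^2 + z), so the derivative at x
    is 1 / (c t). This matches the value at 0 because 1 + c = 1 / t.\<close>
  then have "span_poly 1 b x = (c * z)\<^sup>2 + c * (c * z)"
    by (simp add: span_poly_def factor(2))
  also have "\<dots> = c\<^sup>2 * t"
    by (simp add: t_def power2_eq_square algebra_simps)
  finally have P: "span_poly 1 b x = c\<^sup>2 * t" .
  then have xV: "x \<notin> ?V"
    using \<open>c \<noteq> 0\<close> t(1) by (simp flip: span_poly_eq_0_iff)
  have "?D x = c / (c\<^sup>2 * t)"
    using second_derivative_inversion_map[OF xV] by (simp add: P factor(2))
  also have "\<dots> = (1 + c) / c"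
    unfolding c(2) using \<open>c \<noteq> 0\<close> by (simp add: power2_eq_square)
  finally have Dx: "?D x = (1 + c) / c" .
  have "?D v = (1 + c) / c" "?D (x + v) = (1 + c) / c" if "v \<in> ?V" for v
    using second_derivative_add_pair_span[OF that, of inversion_map 0]
      second_derivative_add_pair_span[OF that, of inversion_map x] D0 Dx by simp_all
  then have "?V \<union> (+) x ` ?V \<subseteq> {x. ?D x = (1 + c) / c}"
    by auto
  then have "card (?V \<union> (+) x ` ?V) \<le> card {x. ?D x = (1 + c) / c}"
    by (intro card_mono) simp_all
  moreover have "?V \<inter> (+) x ` ?V = {}"
  proof safe
    fix v assume "v \<in> ?V" "x + v \<in> ?V"
    then have "v + (x + v) \<in> ?V" by (rule pair_span_add)
    with xV show "x + v \<in> {}" by (simp add: ac_simps)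
  qed
  then have "card (?V \<union> (+) x ` ?V) = 8"
    using b01 by (subst card_Un_disjoint) (auto simp: card_image card_pair_span)
  ultimately show ?thesis using b01 by metis
qed

end

theorem proposition8p1:
  fixes n :: nat
  assumes "n \<ge> 6"
    and "CARD('a::finite_field) = 2 ^ n"
  shows "second_order_differential_uniformity (inversion_map :: 'a \<Rightarrow> 'a) = 8"
proof -
  have "CHAR('a) dvd 2 ^ n"
    using CHAR_dvd_CARD[where 'a = 'a] assms(2) by simp
  moreover have "prime CHAR('a)"
    by (rule prime_CHAR_semidom) (simp add: finite_imp_CHAR_pos)
  ultimately have "CHAR('a) = 2"
    using prime_dvd_power primes_dvd_imp_eq two_is_prime_nat by blast
  then have two: "(1 :: 'a) + 1 = 0"
    using of_nat_CHAR[where 'a = 'a] by simp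
  obtain z :: 'a where "z ^ 4 \<noteq> z" "artin_schreier_char (1 + 1 / (z\<^sup>2 + z)) = 1"
      "artin_schreier_char (z + 1 / (z + 1)) = 1"
    using exists_artin_schreier_char_pair[OF two assms(2,1)] by blast
  from exists_card_second_derivative_inversion_map[OF two this]
  obtain b \<beta> :: 'a where b: "b \<noteq> 0" "b \<noteq> 1"
      "card {x. second_derivative inversion_map 1 b x = \<beta>} \<ge> 8"
    by blast
  then have "card {x. second_derivative inversion_map 1 b x = \<beta>} = 8"
    using card_second_derivative_inversion_map_le[OF two, of 1 b \<beta>] by simp
  then have "\<exists>\<alpha> \<alpha>' \<beta> :: 'a. 8 = card {x. second_derivative inversion_map \<alpha> \<alpha>' x = \<beta>}
      \<and> \<alpha> \<noteq> 0 \<and> \<alpha>' \<noteq> 0 \<and> \<alpha> \<noteq> \<alpha>'"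
    using b(1,2) by (metis zero_neq_one)
  then show ?thesis
    unfolding second_order_differential_uniformity_def
    using card_second_derivative_inversion_map_le[OF two]
    \<comment> \<open>The upper bound also makes the set of cardinalities finite.\<close>
    by (intro Max_eqI) (auto intro: finite_subset[of _ "{..8}"])
qed

end
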